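(* Let $p\ge1$, let $\{c_n\}_{n\ge1}$ be a sequence of positive numbers, and let $\{X_{n,j},\ 1\le j\le k_n,\ n\ge1\}$ be an array of random variables satisfying the maximal inequality (M) (stated in the context) for sequences $\{\alpha_n\}$, $\{\beta_n\}$ of nonnegative numbers such that $\alpha_n=O(1)$ and $\beta_n=O(1)$ as $n\to\infty$. Suppose that (i') for all $\lambda>0$, $\sum_{n=1}^{\infty}c_n\sum_{j=1}^{k_n}\mathbb{P}\{|X_{n,j}|>\lambda\}<\infty$, and that there exists a constant $\delta>0$ such that (b') $\sum_{j=1}^{k_n}\mathbb{P}\{|X_{n,j}|>\delta\}=o(1)$ as $n\to\infty$; (c') $\sum_{n=1}^{\infty}\sum_{j=1}^{k_n}c_n\int_{\delta^p}^{\infty}\mathbb{P}\{|X_{n,j}|^p>t\}\,\mathrm{d}t<\infty$; (d') for some $q>p$, $$\sum_{n=1}^{\infty}c_n\Big(\sum_{j=1}^{k_n}\mathbb{V}\big(X_{n,j}I_{\{|X_{n,j}|\le\delta\}}\big)\Big)^{q}<\infty\quad\text{and}\quad\sum_{n=1}^{\infty}c_n\Big(\sum_{j=1}^{k_n}\mathbb{E}|X_{n,j}|I_{\{|X_{n,j}|>\delta\}}\Big)^{q}<\infty.$$ Then, for all $\varepsilon>0$, $$\sum_{n=1}^{\infty}c_n\,\mathbb{E}\Big[\max_{1\le i\le k_n}\Big|\sum_{j=1}^{i}\big(X_{n,j}-\mathbb{E}\,X_{n,j}I_{\{|X_{n,j}|\le\delta\}}\big)\Big|-\varepsilon\Bi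g]_+^{p}<\infty.$$
   Context: $\{k_n\}_{n\ge1}$ is a sequence of positive integers with $k_n\to\infty$ as $n\to\infty$. $I_A$ is the indicator random variable of the event $A$; $\mathbb{V}$ denotes variance; $x_+=\max(x,0)$ and $[x]_+^p=(x_+)^p$. For $\ell>0$, $g_\ell(x)=\max(\min(x,\ell),-\ell)$ is the truncation at level $\ell$. Inequality (M): an array $\{X_{n,j},\ 1\le j\le k_n,\ n\ge1\}$ of random variables satisfies (M) for sequences $\{\alpha_n\}$, $\{\beta_n\}$ of nonnegative numbers if there exist constants $C_1,C_2>0$, not depending on $n,\ell,\lambda,\eta$, such that for each $n\ge1$ and all $\ell,\lambda,\eta>0$, $$\mathbb{P}\Big\{\max_{1\le i\le k_n}\Big|\sum_{j=1}^{i}[g_\ell(X_{n,j})-\mathbb{E}g_\ell(X_{n,j})]\Big|\ge\lambda\Big\}\le \alpha_n\,\mathbb{P}\Big\{\max_{1\le j\le k_n}|g_\ell(X_{n,j})-\mathbb{E}g_\ell(X_{n,j})|>C_1\eta\Big\}+\beta_n\Big\{\frac{\sum_{j=1}^{k_n}\mathbb{E}[g_\ell(X_{n,j})-\mathbb{E}g_\ell(X_{n,j})]^2}{C_2\lambda\eta}\Big\}^{\lambda/\eta}.$$ *)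

theory Defs
  imports "HOL-Probability.Probability" "HOL-Library.Landau_Symbols"
begin

definition trunc :: "real \<Rightarrow> real \<Rightarrow> real" where
  "trunc l x = max (min x l) (- l)"

definition ctrunc :: "'a measure \<Rightarrow> real \<Rightarrow> ('a \<Rightarrow> real) \<Rightarrow> 'a \<Rightarrow> real" where
  "ctrunc M l Y \<omega> = trunc l (Y \<omega>) - prob_space.expectation M (\<lambda>\<omega>'. trunc l (Y \<omega>'))"

text \<open>
  The array is indexed by rows \<open>n \<ge> 1\<close> and columns \<open>1 \<le> j \<le> k n\<close>; values outside this range
  are irrelevant. The constants \<open>C1\<close> and \<open>C2\<close> are chosen uniformly in \<open>n\<close>, \<open>l\<close>, \<open>x\<close> and \<open>y\<close>,
  where \<open>x\<close> and \<open>y\<close> play the roles of \<open>\<lambda>\<close> and \<open>\<eta>\<close>.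
\<close>

definition maximal_ineq ::
  "'a measure \<Rightarrow> (nat \<Rightarrow> nat) \<Rightarrow> (nat \<Rightarrow> nat \<Rightarrow> 'a \<Rightarrow> real) \<Rightarrow> (nat \<Rightarrow> real) \<Rightarrow> (nat \<Rightarrow> real) \<Rightarrow> bool"
where
  "maximal_ineq M k X \<alpha> \<beta> \<longleftrightarrow>
    (\<exists>C1>0. \<exists>C2>0. \<forall>n\<ge>1. \<forall>l>0. \<forall>x>0. \<forall>y>0.
      \<P>(\<omega> in M. (MAX i\<in>{1..k n}. \<bar>\<Sum>j=1..i. ctrunc M l (X n j) \<omega>\<bar>) \<ge> x)
      \<le> \<alpha> n * \<P>(\<omega> in M. (MAX j\<in>{1..k n}. \<bar>ctrunc M l (X n j) \<omega>\<bar>) > C1 * y)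
        + \<beta> n * ((\<Sum>j=1..k n. prob_space.expectation M (\<lambda>\<omega>. (ctrunc M l (X n j) \<omega>)\<^sup>2))
                  / (C2 * x * y)) powr (x / y))"

text \<open>
  Real powers of extended nonnegative numbers, used only with exponents \<open>r > 0\<close>, for which
  \<open>\<infinity>\<close> to the power \<open>r\<close> is \<open>\<infinity>\<close>.
\<close>

definition ennpowr :: "ennreal \<Rightarrow> real \<Rightarrow> ennreal" where
  "ennpowr a r = (if a = \<infinity> then \<infinity> else ennreal (enn2real a powr r))"

end

theory Submission
  imports Defs
begin

text \<open>
  Write \<open>S\<close> for the maximum of the centred partial sums of one row. Since
  \<open>E[S - \<epsilon>]\<^sub>+\<^sup>p\<close> is the integral of \<open>P(S > \<epsilon> + t powr (1 / p))\<close> over \<open>t \<ge> 0\<close>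
  (\<open>nn_integral_excess_powr_eq\<close>), everything rests on one tail bound, valid for all \<open>x \<ge> \<epsilon>\<close> and all
  sufficiently late rows with constants independent of the row
  (\<open>prob_centred_max_tail_le\<close>):
  \<open>P(S > x) \<le> L * (\<Sum>j. P(\<bar>X j\<bar> > \<kappa> * x)) + Q * (V powr q + B powr q) * x powr (- q)\<close>,
  where \<open>V\<close> sums the variances of the variables cut off at \<open>\<delta>\<close> and \<open>B\<close> sums the first moments over
  \<open>\<bar>X j\<bar> > \<delta>\<close>.

  To get it, truncate at a level \<open>l = K * x\<close> that grows with \<open>x\<close>. Unless some variable exceeds \<open>l\<close>,
  truncation affects only the centring, and this shifts the partial sums by at most
  \<open>l * (\<Sum>j. P(\<bar>X j\<bar> > \<delta>))\<close>; hypothesis \<open>b'\<close> makes this at most \<open>x / 2\<close>. The maximal inequality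
  with \<open>y\<close> proportional to \<open>x\<close> handles the truncated sums. Its first term is a sum of tail
  probabilities at a level proportional to \<open>x\<close>, by \<open>prob_ctrunc_gt_le\<close>. In its second term the
  truncated variances sum to at most \<open>2 * V + 2 * l * B\<close> (\<open>expectation_ctrunc_square_le\<close>), and
  dividing by \<open>x\<^sup>2\<close> and raising to the power \<open>q\<close> gives the decay \<open>x powr (- q)\<close>.

  Integrating over \<open>x = \<epsilon> + t powr (1 / p)\<close>, the factor \<open>x powr (- q)\<close> contributes a finite constant because
  \<open>q > p\<close> (\<open>nn_integral_shifted_powr_finite\<close>), so \<open>d'1\<close> and \<open>d'2\<close> bound the second part. The first part reduces
  to the tail integrals of \<open>c'\<close> and the tail probabilities of \<open>i'\<close>
  (\<open>nn_integral_scaled_tail_le\<close>). The finitely many early rows have finite \<open>p\<close>-th moments by \<open>c'\<close>.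
\<close>

section \<open>Truncated random variables\<close>

lemma abs_trunc_le_level: "l > 0 \<Longrightarrow> \<bar>trunc l x\<bar> \<le> l"
  and abs_trunc_le_abs: "l > 0 \<Longrightarrow> \<bar>trunc l x\<bar> \<le> \<bar>x\<bar>"
  and trunc_eq_self: "\<bar>x\<bar> \<le> l \<Longrightarrow> trunc l x = x"
  by (auto simp: trunc_def max_def min_def)

lemma borel_measurable_trunc [measurable (raw)]:
  "f \<in> borel_measurable M \<Longrightarrow> (\<lambda>\<omega>. trunc l (f \<omega>)) \<in> borel_measurable M"
  unfolding trunc_def by measurable

lemma borel_measurable_ctrunc [measurable (raw)]:
  "f \<in> borel_measurable M \<Longrightarrow> ctrunc M l f \<in> borel_measurable M"
  unfolding ctrunc_def[abs_def]
  by (intro borel_measurable_diff borel_measurable_trunc borel_measurable_const)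

context prob_space
begin

lemma integrable_trunc:
  assumes "Y \<in> borel_measurable M" "l > 0"
  shows "integrable M (\<lambda>\<omega>. trunc l (Y \<omega>))"
  by (rule integrable_const_bound[where B = l]) (use assms abs_trunc_le_level in auto)

text \<open>
  The mean of the truncated variable need not be small compared with \<open>u\<close>, so the centring cannot
  simply be dropped. But the truncated variable and its mean are each at most \<open>u / 4\<close> in absolute
  value, apart from a contribution of the event \<open>\<bar>Y\<bar> > u / 4\<close>. The two contributions together
  have expectation at most \<open>2 * l\<close> times the probability of that event and must exceed \<open>u / 2\<close>,
  so Markov's inequality applies.
\<close>

lemma prob_ctrunc_gt_le:
  assumes [measurable]: "Y \<in> borel_measurable M" and l: "l > 0" and u: "u > 0"
  shows "\<P>(\<omega> in M. \<bar>ctrunc M l Y \<omega>\<bar> > u) \<le> 4 * l / u * \<P>(\<omega> in M. \<bar>Y \<omega>\<bar> > u / 4)"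
proof -
  define I where "I = (\<lambda>\<omega>. indicat_real {\<omega>\<in>space M. \<bar>Y \<omega>\<bar> > u / 4} \<omega>)"
  define P where "P = \<P>(\<omega> in M. \<bar>Y \<omega>\<bar> > u / 4)"
  have P0: "P \<ge> 0" by (simp add: P_def)
  have I_meas [measurable]: "I \<in> borel_measurable M" unfolding I_def by measurable
  have I_int: "integrable M I" by (rule integrable_const_bound[where B = 1]) (auto simp: I_def)
  have EI: "expectation I = P" by (simp add: I_def P_def)
  have bd: "\<bar>trunc l (Y \<omega>)\<bar> \<le> u / 4 + l * I \<omega>" if "\<omega> \<in> space M" for \<omega>
    using abs_trunc_le_level[OF l, of "Y \<omega>"] abs_trunc_le_abs[OF l, of "Y \<omega>"] that u
    by (auto simp: I_def indicator_def)
  have "\<bar>expectation (\<lambda>\<omega>. trunc l (Y \<omega>))\<bar> \<le> expectation (\<lambda>\<omega>. \<bar>trunc l (Y \<omega>)\<bar>)"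
    using integral_abs_bound by blast
  also have "\<dots> \<le> expectation (\<lambda>\<omega>. u / 4 + l * I \<omega>)"
    by (rule integral_mono) (use bd I_int integrable_trunc[OF assms(1) l] in auto)
  also have "\<dots> = u / 4 + l * P" using I_int EI by (simp add: prob_space)
  finally have mean: "\<bar>expectation (\<lambda>\<omega>. trunc l (Y \<omega>))\<bar> \<le> u / 4 + l * P" .
  have "\<P>(\<omega> in M. \<bar>ctrunc M l Y \<omega>\<bar> > u) \<le> \<P>(\<omega> in M. l * I \<omega> + l * P \<ge> u / 2)"
  proof (rule finite_measure_mono)
    show "{\<omega> \<in> space M. u < \<bar>ctrunc M l Y \<omega>\<bar>} \<subseteq> {\<omega> \<in> space M. u / 2 \<le> l * I \<omega> + l * P}"
    proof safe
      fix \<omega> assume "\<omega> \<in> space M" and "u < \<bar>ctrunc M l Y \<omega>\<bar>"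
      with bd[of \<omega>] mean show "u / 2 \<le> l * I \<omega> + l * P" unfolding ctrunc_def by linarith
    qed
  qed measurable
  also have "\<dots> \<le> expectation (\<lambda>\<omega>. l * I \<omega> + l * P) / (u / 2)"
    by (rule integral_Markov_inequality_measure[where A = "{}"])
      (use I_int u l P0 in \<open>auto simp: I_def\<close>)
  also have "expectation (\<lambda>\<omega>. l * I \<omega> + l * P) = 2 * l * P"
    using I_int EI by (simp add: prob_space)
  finally show ?thesis using u by (simp add: P_def field_simps)
qed

text \<open>
  Truncating at \<open>l\<close> and cutting off at \<open>\<delta>\<close> differ only where \<open>\<bar>Y\<bar> > \<delta>\<close>, and there by at most \<open>l\<close>.
  The bound is linear in \<open>l\<close>, so for \<open>l\<close> proportional to a deviation \<open>x\<close> the drift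
  caused by changing the centring is a small multiple of \<open>x\<close> once the tail probabilities are small.
\<close>

lemma abs_expectation_trunc_diff_le:
  assumes [measurable]: "Y \<in> borel_measurable M" and "\<delta> > 0" "l \<ge> \<delta>"
  shows "\<bar>expectation (\<lambda>\<omega>. trunc l (Y \<omega>))
      - expectation (\<lambda>\<omega>. Y \<omega> * indicator {\<omega>. \<bar>Y \<omega>\<bar> \<le> \<delta>} \<omega>)\<bar>
    \<le> l * \<P>(\<omega> in M. \<bar>Y \<omega>\<bar> > \<delta>)"
proof -
  have l: "l > 0" using assms by simp
  have int: "integrable M (\<lambda>\<omega>. Y \<omega> * indicator {\<omega>. \<bar>Y \<omega>\<bar> \<le> \<delta>} \<omega>)"
    by (rule integrable_const_bound[where B = \<delta>]) (use assms in \<open>auto simp: indicator_def\<close>)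
  let ?I = "\<lambda>\<omega>. indicat_real {\<omega>\<in>space M. \<bar>Y \<omega>\<bar> > \<delta>} \<omega>"
  have I_int: "integrable M ?I" by (rule integrable_const_bound[where B = 1]) auto
  have "\<bar>expectation (\<lambda>\<omega>. trunc l (Y \<omega>))
      - expectation (\<lambda>\<omega>. Y \<omega> * indicator {\<omega>. \<bar>Y \<omega>\<bar> \<le> \<delta>} \<omega>)\<bar>
    = \<bar>expectation (\<lambda>\<omega>. trunc l (Y \<omega>) - Y \<omega> * indicator {\<omega>. \<bar>Y \<omega>\<bar> \<le> \<delta>} \<omega>)\<bar>"
    by (subst Bochner_Integration.integral_diff) (use int integrable_trunc assms l in auto)
  also have "\<dots> \<le> expectation (\<lambda>\<omega>. \<bar>trunc l (Y \<omega>) - Y \<omega> * indicator {\<omega>. \<bar>Y \<omega>\<bar> \<le> \<delta>} \<omega>\<bar>)"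
    using integral_abs_bound by blast
  also have "\<dots> \<le> expectation (\<lambda>\<omega>. l * ?I \<omega>)"
  proof (rule integral_mono)
    fix \<omega> assume "\<omega> \<in> space M"
    then show "\<bar>trunc l (Y \<omega>) - Y \<omega> * indicator {\<omega>. \<bar>Y \<omega>\<bar> \<le> \<delta>} \<omega>\<bar> \<le> l * ?I \<omega>"
      using abs_trunc_le_level[OF l, of "Y \<omega>"] trunc_eq_self[of "Y \<omega>" l] assms
      by (auto simp: indicator_def)
  qed (use I_int int integrable_trunc assms l in auto)
  also have "\<dots> = l * \<P>(\<omega> in M. \<bar>Y \<omega>\<bar> > \<delta>)" using I_int by simp
  finally show ?thesis .
qed

lemma variance_le_expectation_square:
  fixes f :: "'a \<Rightarrow> real"
  assumes "integrable M f" "integrable M (\<lambda>\<omega>. (f \<omega>)\<^sup>2)"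
  shows "variance f \<le> expectation (\<lambda>\<omega>. (f \<omega> - m)\<^sup>2)"
proof -
  have "expectation (\<lambda>\<omega>. (f \<omega> - m)\<^sup>2)
      = expectation (\<lambda>\<omega>. (f \<omega>)\<^sup>2) - 2 * m * expectation f + m\<^sup>2"
    using assms by (simp add: power2_diff prob_space mult.commute mult.left_commute)
  moreover have "variance f = expectation (\<lambda>\<omega>. (f \<omega>)\<^sup>2) - (expectation f)\<^sup>2"
    using assms by (simp add: variance_eq)
  moreover have "2 * m * expectation f \<le> (expectation f)\<^sup>2 + m\<^sup>2"
    using zero_le_power2[of "expectation f - m"] by (simp add: power2_diff mult_ac)
  ultimately show ?thesis by simp
qed

text \<open>
  The variance is at most the second moment about the mean of the variable cut off at \<open>\<delta>\<close>. Off the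
  event \<open>\<bar>Y\<bar> > \<delta>\<close> nothing changes, and on it the square of the truncated variable is at most
  \<open>l * \<bar>Y\<bar>\<close>. One factor \<open>l\<close> instead of two is what later
  matches the first moment over \<open>\<bar>Y\<bar> > \<delta>\<close> with the decay \<open>x powr (- q)\<close>.
\<close>

lemma expectation_ctrunc_square_le:
  assumes [measurable]: "Y \<in> borel_measurable M" and \<delta>: "\<delta> > 0" "l \<ge> \<delta>"
    and int: "integrable M (\<lambda>\<omega>. \<bar>Y \<omega>\<bar> * indicator {\<omega>. \<bar>Y \<omega>\<bar> > \<delta>} \<omega>)"
  shows "expectation (\<lambda>\<omega>. (ctrunc M l Y \<omega>)\<^sup>2)
    \<le> 2 * variance (\<lambda>\<omega>. Y \<omega> * indicator {\<omega>. \<bar>Y \<omega>\<bar> \<le> \<delta>} \<omega>)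
      + 2 * l * expectation (\<lambda>\<omega>. \<bar>Y \<omega>\<bar> * indicator {\<omega>. \<bar>Y \<omega>\<bar> > \<delta>} \<omega>)"
proof -
  have l: "l > 0" using \<delta> by simp
  let ?T = "\<lambda>\<omega>. trunc l (Y \<omega>)"
  let ?Z = "\<lambda>\<omega>. Y \<omega> * indicator {\<omega>. \<bar>Y \<omega>\<bar> \<le> \<delta>} \<omega>"
  let ?W = "\<lambda>\<omega>. \<bar>Y \<omega>\<bar> * indicator {\<omega>. \<bar>Y \<omega>\<bar> > \<delta>} \<omega>"
  define m where "m = expectation ?Z"
  have T_int: "integrable M ?T" by (rule integrable_trunc) (use l in auto)
  have sq_int: "integrable M (\<lambda>\<omega>. (f \<omega> - a)\<^sup>2)"
    if [measurable]: "f \<in> borel_measurable M" and f: "\<And>\<omega>. \<bar>f \<omega>\<bar> \<le> b" for f :: "'a \<Rightarrow> real" and a b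
  proof (rule integrable_const_bound[where B = "(b + \<bar>a\<bar>)\<^sup>2"])
    have "\<bar>f \<omega> - a\<bar> \<le> \<bar>b + \<bar>a\<bar>\<bar>" for \<omega> using f[of \<omega>] by linarith
    then show "AE \<omega> in M. norm ((f \<omega> - a)\<^sup>2) \<le> (b + \<bar>a\<bar>)\<^sup>2"
      by (intro AE_I2) (simp add: abs_le_square_iff[symmetric])
  qed measurable
  have "expectation (\<lambda>\<omega>. (ctrunc M l Y \<omega>)\<^sup>2) = variance ?T" by (simp add: ctrunc_def)
  also have "\<dots> \<le> expectation (\<lambda>\<omega>. (?T \<omega> - m)\<^sup>2)"
    using T_int sq_int[of ?T l 0] abs_trunc_le_level[OF l]
    by (intro variance_le_expectation_square) auto
  also have "\<dots> \<le> expectation (\<lambda>\<omega>. 2 * (?Z \<omega> - m)\<^sup>2 + 2 * l * ?W \<omega>)"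
  proof (rule integral_mono)
    show "integrable M (\<lambda>\<omega>. (?T \<omega> - m)\<^sup>2)"
      by (rule sq_int[of ?T l]) (use abs_trunc_le_level[OF l] in auto)
    have "integrable M (\<lambda>\<omega>. (?Z \<omega> - m)\<^sup>2)"
      by (rule sq_int[of ?Z \<delta>]) (use \<delta> in \<open>auto simp: indicator_def\<close>)
    then show "integrable M (\<lambda>\<omega>. 2 * (?Z \<omega> - m)\<^sup>2 + 2 * l * ?W \<omega>)" using int by auto
    fix \<omega>
    show "(?T \<omega> - m)\<^sup>2 \<le> 2 * (?Z \<omega> - m)\<^sup>2 + 2 * l * ?W \<omega>"
    proof (cases "\<bar>Y \<omega>\<bar> \<le> \<delta>")
      case True
      then show ?thesis using \<delta> by (simp add: trunc_eq_self)
    next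
      case False
      have "(?T \<omega>)\<^sup>2 = \<bar>?T \<omega>\<bar> * \<bar>?T \<omega>\<bar>" by (simp add: power2_eq_square)
      also have "\<dots> \<le> l * \<bar>Y \<omega>\<bar>"
        by (rule mult_mono) (use abs_trunc_le_level[OF l] abs_trunc_le_abs[OF l] l in auto)
      finally have "(?T \<omega>)\<^sup>2 \<le> l * \<bar>Y \<omega>\<bar>" .
      moreover have "(?T \<omega> - m)\<^sup>2 \<le> 2 * m\<^sup>2 + 2 * (?T \<omega>)\<^sup>2"
        using zero_le_power2[of "?T \<omega> + m"] by (simp add: power2_diff power2_sum)
      ultimately show ?thesis using False by simp
    qed
  qed
  also have "\<dots> = 2 * variance ?Z + 2 * l * expectation ?W"
    unfolding m_def using int sq_int[of ?Z \<delta>] \<delta> by (simp add: indicator_def abs_if)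
  finally show ?thesis .
qed

end

section \<open>Powers and tail integrals\<close>

lemma powr_sum_le:
  fixes a :: "'i \<Rightarrow> real"
  assumes "finite A" "\<And>i. i \<in> A \<Longrightarrow> a i \<ge> 0" "r > 0"
  shows "(\<Sum>i\<in>A. a i) powr r \<le> real (card A) powr r * (\<Sum>i\<in>A. a i powr r)"
proof (cases "A = {}")
  case False
  have "Max (a ` A) \<in> a ` A" using assms False by simp
  then obtain i where i: "i \<in> A" "a i = Max (a ` A)" by force
  have "(\<Sum>i\<in>A. a i) \<le> real (card A) * a i"
    by (rule sum_bounded_above) (use i assms in simp)
  then have "(\<Sum>i\<in>A. a i) powr r \<le> (real (card A) * a i) powr r"
    using assms by (intro powr_mono2 sum_nonneg) auto
  also have "\<dots> = real (card A) powr r * a i powr r"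
    using assms i by (simp add: powr_mult)
  also have "\<dots> \<le> real (card A) powr r * (\<Sum>i\<in>A. a i powr r)"
    by (intro mult_left_mono member_le_sum) (use assms i in auto)
  finally show ?thesis .
qed simp

lemma powr_add_le:
  fixes a b r :: real
  assumes "a \<ge> 0" "b \<ge> 0" "r > 0"
  shows "(a + b) powr r \<le> 2 powr r * (a powr r + b powr r)"
  using powr_sum_le[of "{False, True}" "\<lambda>i. if i then a else b" r] assms
  by (simp add: add.commute)

text \<open>
  This is the place where \<open>q > p\<close> is needed: the integrand decays like \<open>t powr (- q / p)\<close>.
\<close>

lemma nn_integral_shifted_powr_finite:
  fixes \<epsilon> p q :: real
  assumes "\<epsilon> > 0" "p \<ge> 1" "q > p"
  shows "(\<integral>\<^sup>+t\<in>{0..}. ennreal ((\<epsilon> + t powr (1 / p)) powr (- q)) \<partial>lborel) < \<infinity>"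
proof -
  define e where "e = \<epsilon> powr p"
  define r where "r = q / p"
  have e: "e > 0" and r: "r > 1" using assms by (auto simp: e_def r_def)
  \<comment> \<open>The \<open>p\<close>-th power of \<open>\<epsilon> + t powr (1 / p)\<close> dominates
    both \<open>\<epsilon> powr p\<close> and \<open>t\<close>, hence their average.\<close>
  have le: "(\<epsilon> + t powr (1 / p)) powr (- q) \<le> 2 powr r * (e + t) powr (- r)" if t: "t \<ge> 0" for t
  proof -
    let ?x = "\<epsilon> + t powr (1 / p)"
    have "e \<le> ?x powr p" unfolding e_def by (rule powr_mono2) (use assms in auto)
    moreover have "t = (t powr (1 / p)) powr p" using assms t by (simp add: powr_powr)
    then have "t \<le> ?x powr p"
      by (metis assms(1,2) dual_order.trans le_add_same_cancel2 less_eq_real_def powr_ge_zero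
          powr_mono2 zero_le_one)
    ultimately have "(e + t) / 2 \<le> ?x powr p" by simp
    then have "(?x powr p) powr (- r) \<le> ((e + t) / 2) powr (- r)"
      using e t r by (intro powr_mono2') auto
    also have "\<dots> = 2 powr r * (e + t) powr (- r)"
      using e t by (simp add: powr_divide powr_minus field_simps)
    finally show ?thesis using assms by (simp add: powr_powr r_def)
  qed
  \<comment> \<open>Since \<open>r > 1\<close>, this antiderivative of \<open>(e + t) powr (- r)\<close> vanishes at infinity.\<close>
  let ?F = "\<lambda>t. (e + t) powr (1 - r) / (1 - r)"
  have "(\<integral>\<^sup>+t\<in>{0..}. ennreal ((e + t) powr (- r)) \<partial>lborel) = ennreal (0 - ?F 0)"
  proof (rule nn_integral_FTC_atLeast)
    show "(?F \<longlongrightarrow> 0) at_top" using e r by real_asymp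
    fix t :: real assume "0 \<le> t"
    then show "DERIV ?F t :> (e + t) powr (- r)"
      using e r by (auto intro!: derivative_eq_intros)
  qed auto
  then have fin: "(\<integral>\<^sup>+t\<in>{0..}. ennreal ((e + t) powr (- r)) \<partial>lborel) < \<infinity>" by simp
  have "(\<integral>\<^sup>+t\<in>{0..}. ennreal ((\<epsilon> + t powr (1 / p)) powr (- q)) \<partial>lborel)
      \<le> (\<integral>\<^sup>+t. ennreal (2 powr r) * (ennreal ((e + t) powr (- r)) * indicator {0..} t) \<partial>lborel)"
    by (rule nn_integral_mono) (use le in \<open>auto simp: indicator_def ennreal_mult[symmetric] intro!: ennreal_leI\<close>)
  also have "\<dots> = ennreal (2 powr r) * (\<integral>\<^sup>+t\<in>{0..}. ennreal ((e + t) powr (- r)) \<partial>lborel)"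
    by (rule nn_integral_cmult) measurable
  also have "\<dots> < \<infinity>" using fin by (simp add: ennreal_mult_less_top)
  finally show ?thesis .
qed

lemma ennreal_le_mult_add:
  fixes a b c x :: real
  assumes "x \<le> c * (a + b)" "a \<ge> 0" "b \<ge> 0" "c \<ge> 0"
  shows "ennreal x \<le> ennreal c * (ennreal a + ennreal b)"
  using ennreal_leI[OF assms(1)] assms(2-) by (simp add: ennreal_mult ennreal_plus)

context prob_space
begin

text \<open>
  Layer-cake formula above the level \<open>a\<close>: for fixed \<open>\<omega>\<close>, the set of \<open>t \<ge> a\<close> with \<open>t < Z \<omega>\<close> is an
  interval of length \<open>max 0 (Z \<omega> - a)\<close>; exchange the integrals.
\<close>

lemma nn_integral_tail_eq:
  fixes Z :: "'a \<Rightarrow> real"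
  assumes [measurable]: "Z \<in> borel_measurable M"
  shows "(\<integral>\<^sup>+t\<in>{a..}. ennreal \<P>(\<omega> in M. Z \<omega> > t) \<partial>lborel)
    = (\<integral>\<^sup>+\<omega>. ennreal (max 0 (Z \<omega> - a)) \<partial>M)"
proof -
  interpret P: pair_sigma_finite lborel M ..
  let ?h = "\<lambda>(t, \<omega>). indicator {a..} t * indicator {0<..} (Z \<omega> - t) :: ennreal"
  have "(\<integral>\<^sup>+t\<in>{a..}. ennreal \<P>(\<omega> in M. Z \<omega> > t) \<partial>lborel)
      = (\<integral>\<^sup>+t. (\<integral>\<^sup>+\<omega>. ?h (t, \<omega>) \<partial>M) \<partial>lborel)"
  proof (rule nn_integral_cong)
    fix t :: real
    have "(\<integral>\<^sup>+\<omega>. ?h (t, \<omega>) \<partial>M) = (\<integral>\<^sup>+\<omega>. indicator {a..} t * indicator {\<omega> \<in> space M. Z \<omega> > t} \<omega> \<partial>M)"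
      by (rule nn_integral_cong) (auto simp: indicator_def)
    also have "\<dots> = indicator {a..} t * ennreal \<P>(\<omega> in M. Z \<omega> > t)"
      by (subst nn_integral_cmult_indicator) (auto simp: emeasure_eq_measure)
    finally show "ennreal \<P>(\<omega> in M. Z \<omega> > t) * indicator {a..} t = (\<integral>\<^sup>+\<omega>. ?h (t, \<omega>) \<partial>M)"
      by (simp add: mult.commute)
  qed
  also have "\<dots> = (\<integral>\<^sup>+\<omega>. (\<integral>\<^sup>+t. ?h (t, \<omega>) \<partial>lborel) \<partial>M)"
    by (rule P.Fubini'[symmetric]) measurable
  also have "\<dots> = (\<integral>\<^sup>+\<omega>. ennreal (max 0 (Z \<omega> - a)) \<partial>M)"
  proof (rule nn_integral_cong)
    fix \<omega>
    have "(\<integral>\<^sup>+t. ?h (t, \<omega>) \<partial>lborel) = (\<integral>\<^sup>+t. indicator {a..<Z \<omega>} t \<partial>lborel)"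
      by (rule nn_integral_cong) (auto simp: indicator_def)
    also have "\<dots> = ennreal (max 0 (Z \<omega> - a))"
      by (cases "a \<le> Z \<omega>") auto
    finally show "(\<integral>\<^sup>+t. ?h (t, \<omega>) \<partial>lborel) = ennreal (max 0 (Z \<omega> - a))" .
  qed
  finally show ?thesis .
qed

text \<open>
  For \<open>t \<ge> 0\<close>, the \<open>p\<close>-th power of the excess is larger than \<open>t\<close> exactly where
  \<open>Y \<omega> > \<epsilon> + t powr (1 / p)\<close>, so this is the layer-cake formula for that power.
\<close>

lemma nn_integral_excess_powr_eq:
  fixes Y :: "'a \<Rightarrow> real"
  assumes [measurable]: "Y \<in> borel_measurable M" and p: "p > 0"
  shows "(\<integral>\<^sup>+\<omega>. ennreal (max 0 (Y \<omega> - \<epsilon>) powr p) \<partial>M)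
    = (\<integral>\<^sup>+t\<in>{0..}. ennreal \<P>(\<omega> in M. Y \<omega> > \<epsilon> + t powr (1 / p)) \<partial>lborel)"
proof -
  have *: "max 0 y powr p > t \<longleftrightarrow> y > t powr (1 / p)" if "t \<ge> 0" for y t :: real
  proof -
    have t: "t = (t powr (1 / p)) powr p" using p that by (simp add: powr_powr)
    show ?thesis
    proof
      assume "max 0 y powr p > t"
      then have "max 0 y > t powr (1 / p)"
        using powr_mono2[of p "max 0 y" "t powr (1/p)"] t p by (metis linorder_not_less max.cobounded1 order_less_imp_le)
      then show "y > t powr (1 / p)" by (smt (verit) powr_ge_zero)
    next
      assume y: "y > t powr (1 / p)"
      then have "y powr p > (t powr (1 / p)) powr p" by (intro powr_less_mono2) (use p in auto)
      moreover have "max 0 y = y" using y powr_ge_zero[of t "1/p"] by linarith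
      ultimately show "max 0 y powr p > t" using t by simp
    qed
  qed
  have "(\<integral>\<^sup>+\<omega>. ennreal (max 0 (Y \<omega> - \<epsilon>) powr p) \<partial>M)
      = (\<integral>\<^sup>+\<omega>. ennreal (max 0 (max 0 (Y \<omega> - \<epsilon>) powr p - 0)) \<partial>M)" by simp
  also have "\<dots> = (\<integral>\<^sup>+t\<in>{0..}. ennreal \<P>(\<omega> in M. max 0 (Y \<omega> - \<epsilon>) powr p > t) \<partial>lborel)"
    by (rule nn_integral_tail_eq[symmetric]) measurable
  also have "\<dots> = (\<integral>\<^sup>+t\<in>{0..}. ennreal \<P>(\<omega> in M. Y \<omega> > \<epsilon> + t powr (1 / p)) \<partial>lborel)"
  proof (rule nn_integral_cong)
    fix t :: real
    have "(max 0 (Y \<omega> - \<epsilon>) powr p > t) = (Y \<omega> > \<epsilon> + t powr (1 / p))" if "t \<ge> 0" for \<omega>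
      using *[OF that, of "Y \<omega> - \<epsilon>"] by auto
    then show "ennreal \<P>(\<omega> in M. max 0 (Y \<omega> - \<epsilon>) powr p > t) * indicator {0..} t
      = ennreal \<P>(\<omega> in M. Y \<omega> > \<epsilon> + t powr (1 / p)) * indicator {0..} t"
      by (cases "t \<ge> 0") (auto simp: indicator_def)
  qed
  finally show ?thesis .
qed

text \<open>
  The left side is the expectation of \<open>max 0 (\<bar>Y\<bar> / \<kappa> - \<epsilon>) powr p\<close>, which is zero unless
  \<open>\<bar>Y\<bar> > \<kappa> * \<epsilon>\<close> and is then at most \<open>\<kappa> powr (- p) * \<bar>Y\<bar> powr p\<close>. Splitting the \<open>p\<close>-th power at \<open>\<delta> powr p\<close>
  leaves the tail integral above \<open>\<delta> powr p\<close> and a multiple of one tail probability.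
\<close>

lemma nn_integral_scaled_tail_le:
  fixes Y :: "'a \<Rightarrow> real"
  assumes [measurable]: "Y \<in> borel_measurable M" and p: "p > 0" and \<delta>: "\<delta> > 0"
    and \<kappa>: "\<kappa> > 0" and \<epsilon>: "\<epsilon> > 0"
  shows "(\<integral>\<^sup>+t\<in>{0..}. ennreal \<P>(\<omega> in M. \<bar>Y \<omega>\<bar> > \<kappa> * (\<epsilon> + t powr (1 / p))) \<partial>lborel)
    \<le> ennreal (\<kappa> powr (- p)) *
      ((\<integral>\<^sup>+t\<in>{\<delta> powr p..}. ennreal \<P>(\<omega> in M. \<bar>Y \<omega>\<bar> powr p > t) \<partial>lborel)
        + ennreal (\<delta> powr p * \<P>(\<omega> in M. \<bar>Y \<omega>\<bar> > \<kappa> * \<epsilon>)))"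
proof -
  let ?I = "\<lambda>\<omega>. indicat_real {\<omega> \<in> space M. \<bar>Y \<omega>\<bar> > \<kappa> * \<epsilon>} \<omega>"
  have "(\<integral>\<^sup>+t\<in>{0..}. ennreal \<P>(\<omega> in M. \<bar>Y \<omega>\<bar> > \<kappa> * (\<epsilon> + t powr (1 / p))) \<partial>lborel)
     = (\<integral>\<^sup>+t\<in>{0..}. ennreal \<P>(\<omega> in M. \<bar>Y \<omega>\<bar> / \<kappa> > \<epsilon> + t powr (1 / p)) \<partial>lborel)"
    using \<kappa> by (simp add: pos_less_divide_eq mult.commute)
  also have "\<dots> = (\<integral>\<^sup>+\<omega>. ennreal (max 0 (\<bar>Y \<omega>\<bar> / \<kappa> - \<epsilon>) powr p) \<partial>M)"
    by (rule nn_integral_excess_powr_eq[symmetric]) (use p in auto)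
  also have "\<dots> \<le> (\<integral>\<^sup>+\<omega>. ennreal (\<kappa> powr (- p)) *
      (ennreal (max 0 (\<bar>Y \<omega>\<bar> powr p - \<delta> powr p)) + ennreal (\<delta> powr p * ?I \<omega>)) \<partial>M)"
  proof (rule nn_integral_mono)
    fix \<omega> assume \<omega>: "\<omega> \<in> space M"
    have "max 0 (\<bar>Y \<omega>\<bar> / \<kappa> - \<epsilon>) powr p
        \<le> \<kappa> powr (- p) * (max 0 (\<bar>Y \<omega>\<bar> powr p - \<delta> powr p) + \<delta> powr p * ?I \<omega>)"
    proof (cases "\<bar>Y \<omega>\<bar> > \<kappa> * \<epsilon>")
      case True
      have "max 0 (\<bar>Y \<omega>\<bar> / \<kappa> - \<epsilon>) powr p \<le> (\<bar>Y \<omega>\<bar> / \<kappa>) powr p"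
        by (rule powr_mono2) (use p \<epsilon> \<kappa> in auto)
      also have "\<dots> = \<kappa> powr (- p) * \<bar>Y \<omega>\<bar> powr p"
        using \<kappa> by (simp add: powr_divide powr_minus field_simps)
      also have "\<dots> \<le> \<kappa> powr (- p) * (max 0 (\<bar>Y \<omega>\<bar> powr p - \<delta> powr p) + \<delta> powr p)"
        by (rule mult_left_mono) auto
      finally show ?thesis using True \<omega> by simp
    next
      case False
      then have "max 0 (\<bar>Y \<omega>\<bar> / \<kappa> - \<epsilon>) = 0" using \<kappa> by (simp add: field_simps)
      then show ?thesis by simp
    qed
    then show "ennreal (max 0 (\<bar>Y \<omega>\<bar> / \<kappa> - \<epsilon>) powr p) \<le> ennreal (\<kappa> powr (- p)) *
      (ennreal (max 0 (\<bar>Y \<omega>\<bar> powr p - \<delta> powr p)) + ennreal (\<delta> powr p * ?I \<omega>))"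
      by (intro ennreal_le_mult_add) auto
  qed
  also have "\<dots> = ennreal (\<kappa> powr (- p)) *
      ((\<integral>\<^sup>+\<omega>. ennreal (max 0 (\<bar>Y \<omega>\<bar> powr p - \<delta> powr p)) \<partial>M)
        + (\<integral>\<^sup>+\<omega>. ennreal (\<delta> powr p) * indicator {\<omega> \<in> space M. \<bar>Y \<omega>\<bar> > \<kappa> * \<epsilon>} \<omega> \<partial>M))"
    by (subst nn_integral_cmult, measurable, subst nn_integral_add, measurable)
      (simp add: ennreal_mult ennreal_indicator)
  also have "(\<integral>\<^sup>+\<omega>. ennreal (\<delta> powr p) * indicator {\<omega> \<in> space M. \<bar>Y \<omega>\<bar> > \<kappa> * \<epsilon>} \<omega> \<partial>M)
      = ennreal (\<delta> powr p * \<P>(\<omega> in M. \<bar>Y \<omega>\<bar> > \<kappa> * \<epsilon>))"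
    by (subst nn_integral_cmult_indicator) (auto simp: emeasure_eq_measure ennreal_mult)
  also have "(\<integral>\<^sup>+\<omega>. ennreal (max 0 (\<bar>Y \<omega>\<bar> powr p - \<delta> powr p)) \<partial>M)
      = (\<integral>\<^sup>+t\<in>{\<delta> powr p..}. ennreal \<P>(\<omega> in M. \<bar>Y \<omega>\<bar> powr p > t) \<partial>lborel)"
    by (rule nn_integral_tail_eq[symmetric]) measurable
  finally show ?thesis .
qed

end

section \<open>Tail of the maximal partial sum of one row\<close>

definition centred_max :: "'a measure \<Rightarrow> real \<Rightarrow> nat \<Rightarrow> (nat \<Rightarrow> 'a \<Rightarrow> real) \<Rightarrow> 'a \<Rightarrow> real" where
  "centred_max M \<delta> m Y \<omega> = (MAX i\<in>{1..m}. \<bar>\<Sum>j=1..i. (Y j \<omega> - prob_space.expectation M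
      (\<lambda>\<omega>'. Y j \<omega>' * indicator {\<omega>. \<bar>Y j \<omega>\<bar> \<le> \<delta>} \<omega>'))\<bar>)"

lemma borel_measurable_centred_max:
  assumes "\<And>j. j \<in> {1..m} \<Longrightarrow> Y j \<in> borel_measurable M"
  shows "centred_max M \<delta> m Y \<in> borel_measurable M"
  unfolding centred_max_def[abs_def]
  by (intro borel_measurable_Max borel_measurable_abs borel_measurable_sum borel_measurable_diff
      borel_measurable_const assms) auto

context prob_space
begin

lemma prob_Bex_le_sum:
  assumes "finite A" "\<And>j. j \<in> A \<Longrightarrow> {\<omega> \<in> space M. Q j \<omega>} \<in> events"
  shows "\<P>(\<omega> in M. \<exists>j\<in>A. Q j \<omega>) \<le> (\<Sum>j\<in>A. \<P>(\<omega> in M. Q j \<omega>))"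
proof -
  have "{\<omega> \<in> space M. \<exists>j\<in>A. Q j \<omega>} = (\<Union>j\<in>A. {\<omega> \<in> space M. Q j \<omega>})" by auto
  then show ?thesis
    using finite_measure_subadditive_finite[of A "\<lambda>j. {\<omega> \<in> space M. Q j \<omega>}"] assms by auto
qed

text \<open>
  If no variable of the row exceeds \<open>l\<close>, truncation changes nothing but the centring, and the
  resulting drift of the partial sums is at most \<open>x / 2\<close>; the centred truncated sums must then
  account for the other half of \<open>x\<close>.
\<close>

lemma prob_centred_max_gt_le:
  fixes Y :: "nat \<Rightarrow> 'a \<Rightarrow> real"
  assumes m: "m > 0" and meas: "\<And>j. j \<in> {1..m} \<Longrightarrow> Y j \<in> borel_measurable M"
    and \<delta>: "\<delta> > 0" "l \<ge> \<delta>"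
    and small: "l * (\<Sum>j=1..m. \<P>(\<omega> in M. \<bar>Y j \<omega>\<bar> > \<delta>)) \<le> x / 2"
  shows "\<P>(\<omega> in M. centred_max M \<delta> m Y \<omega> > x)
    \<le> (\<Sum>j=1..m. \<P>(\<omega> in M. \<bar>Y j \<omega>\<bar> > l))
      + \<P>(\<omega> in M. (MAX i\<in>{1..m}. \<bar>\<Sum>j=1..i. ctrunc M l (Y j) \<omega>\<bar>) \<ge> x / 2)"
proof -
  let ?E = "\<lambda>j. expectation (\<lambda>\<omega>. trunc l (Y j \<omega>))"
  let ?F = "\<lambda>j. expectation (\<lambda>\<omega>. Y j \<omega> * indicator {\<omega>. \<bar>Y j \<omega>\<bar> \<le> \<delta>} \<omega>)"
  let ?T = "\<lambda>\<omega>. MAX i\<in>{1..m}. \<bar>\<Sum>j=1..i. ctrunc M l (Y j) \<omega>\<bar>"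
  have T_meas [measurable]: "?T \<in> borel_measurable M"
    by (intro borel_measurable_Max borel_measurable_abs borel_measurable_sum borel_measurable_ctrunc meas) auto
  have ev [measurable]: "{\<omega> \<in> space M. \<exists>j\<in>{1..m}. \<bar>Y j \<omega>\<bar> > l} \<in> events"
  proof -
    have "{\<omega> \<in> space M. \<bar>Y j \<omega>\<bar> > l} \<in> events" if "j \<in> {1..m}" for j
      using meas[OF that] by measurable
    then show ?thesis by (intro sets.sets_Collect_finite_Ex) auto
  qed
  have drift: "\<bar>\<Sum>j=1..i. (?E j - ?F j)\<bar> \<le> x / 2" if i: "i \<in> {1..m}" for i
  proof -
    have "\<bar>\<Sum>j=1..i. (?E j - ?F j)\<bar> \<le> (\<Sum>j=1..i. \<bar>?E j - ?F j\<bar>)" by (rule sum_abs)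
    also have "\<dots> \<le> (\<Sum>j=1..m. \<bar>?E j - ?F j\<bar>)" by (rule sum_mono2) (use i in auto)
    also have "\<dots> \<le> (\<Sum>j=1..m. l * \<P>(\<omega> in M. \<bar>Y j \<omega>\<bar> > \<delta>))"
      by (rule sum_mono, rule abs_expectation_trunc_diff_le) (use meas \<delta> in auto)
    also have "\<dots> \<le> x / 2" using small by (simp add: sum_distrib_left)
    finally show ?thesis .
  qed
  have "\<P>(\<omega> in M. centred_max M \<delta> m Y \<omega> > x)
      \<le> prob ({\<omega> \<in> space M. \<exists>j\<in>{1..m}. \<bar>Y j \<omega>\<bar> > l} \<union> {\<omega> \<in> space M. ?T \<omega> \<ge> x / 2})"
  proof (rule finite_measure_mono)
    show "{\<omega> \<in> space M. centred_max M \<delta> m Y \<omega> > x}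
      \<subseteq> {\<omega> \<in> space M. \<exists>j\<in>{1..m}. \<bar>Y j \<omega>\<bar> > l} \<union> {\<omega> \<in> space M. ?T \<omega> \<ge> x / 2}"
    proof (rule subsetI, rule ccontr)
      fix \<omega> assume "\<omega> \<in> {\<omega> \<in> space M. centred_max M \<delta> m Y \<omega> > x}"
        and "\<omega> \<notin> {\<omega> \<in> space M. \<exists>j\<in>{1..m}. \<bar>Y j \<omega>\<bar> > l} \<union> {\<omega> \<in> space M. ?T \<omega> \<ge> x / 2}"
      then have S: "centred_max M \<delta> m Y \<omega> > x" and le: "\<And>j. j \<in> {1..m} \<Longrightarrow> \<bar>Y j \<omega>\<bar> \<le> l"
        and T: "?T \<omega> < x / 2" by (auto simp: not_less)
      from S m obtain i where i: "i \<in> {1..m}" and Si: "\<bar>\<Sum>j=1..i. (Y j \<omega> - ?F j)\<bar> > x"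
        unfolding centred_max_def by (subst (asm) Max_gr_iff) auto
      have "(\<Sum>j=1..i. (Y j \<omega> - ?F j))
          = (\<Sum>j=1..i. ctrunc M l (Y j) \<omega>) + (\<Sum>j=1..i. (?E j - ?F j))"
        using i le by (simp add: sum.distrib[symmetric] ctrunc_def trunc_eq_self)
      moreover have "\<bar>\<Sum>j=1..i. ctrunc M l (Y j) \<omega>\<bar> \<le> ?T \<omega>"
        by (rule Max_ge) (use i in auto)
      ultimately show False using drift[OF i] T Si by linarith
    qed
  qed measurable
  also have "\<dots> \<le> \<P>(\<omega> in M. \<exists>j\<in>{1..m}. \<bar>Y j \<omega>\<bar> > l) + \<P>(\<omega> in M. ?T \<omega> \<ge> x / 2)"
    by (rule measure_Un_le) measurable
  also have "\<P>(\<omega> in M. \<exists>j\<in>{1..m}. \<bar>Y j \<omega>\<bar> > l) \<le> (\<Sum>j=1..m. \<P>(\<omega> in M. \<bar>Y j \<omega>\<bar> > l))"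
  proof (rule prob_Bex_le_sum)
    fix j assume "j \<in> {1..m}"
    then show "{\<omega> \<in> space M. \<bar>Y j \<omega>\<bar> > l} \<in> events" using meas[of j] by measurable
  qed simp
  finally show ?thesis by simp
qed

text \<open>
  The maximal inequality is applied at level \<open>l = K * x\<close> with \<open>x / 2\<close> in place of \<open>x\<close> and
  \<open>y = x / (2 * q)\<close>. The exponent \<open>x / y\<close> becomes \<open>q\<close>, and since \<open>l\<close> and \<open>C1 * y\<close> are both
  proportional to \<open>x\<close>, the factor \<open>4 * l / u\<close> from \<open>prob_ctrunc_gt_le\<close> does not depend on \<open>x\<close>.
  The condition \<open>K * \<epsilon> \<ge> \<delta>\<close> makes \<open>l \<ge> \<delta>\<close>. In the second term,
  \<open>V / x\<^sup>2\<close> and \<open>B / x\<close> are both at most a constant times \<open>(V + B) / x\<close> because \<open>x \<ge> \<epsilon>\<close>.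
  All constants are explicit so that they are visibly the same for every row.
\<close>

lemma prob_centred_max_tail_le:
  fixes Y :: "nat \<Rightarrow> 'a \<Rightarrow> real" and m :: nat and \<delta> :: real
  defines "V \<equiv> \<Sum>j=1..m. variance (\<lambda>\<omega>. Y j \<omega> * indicator {\<omega>. \<bar>Y j \<omega>\<bar> \<le> \<delta>} \<omega>)"
    and "B \<equiv> \<Sum>j=1..m. expectation (\<lambda>\<omega>. \<bar>Y j \<omega>\<bar> * indicator {\<omega>. \<bar>Y j \<omega>\<bar> > \<delta>} \<omega>)"
  assumes m: "m > 0" and meas: "\<And>j. j \<in> {1..m} \<Longrightarrow> Y j \<in> borel_measurable M"
    and \<delta>: "\<delta> > 0"
    and int: "\<And>j. j \<in> {1..m} \<Longrightarrow>
      integrable M (\<lambda>\<omega>. \<bar>Y j \<omega>\<bar> * indicator {\<omega>. \<bar>Y j \<omega>\<bar> > \<delta>} \<omega>)"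
    and C: "C1 > 0" "C2 > 0" and a: "0 \<le> a" "a \<le> a'" and b: "0 \<le> b" "b \<le> b'"
    and ineq: "\<And>l x y. l > 0 \<Longrightarrow> x > 0 \<Longrightarrow> y > 0 \<Longrightarrow>
      \<P>(\<omega> in M. (MAX i\<in>{1..m}. \<bar>\<Sum>j=1..i. ctrunc M l (Y j) \<omega>\<bar>) \<ge> x)
      \<le> a * \<P>(\<omega> in M. (MAX j\<in>{1..m}. \<bar>ctrunc M l (Y j) \<omega>\<bar>) > C1 * y)
        + b * ((\<Sum>j=1..m. expectation (\<lambda>\<omega>. (ctrunc M l (Y j) \<omega>)\<^sup>2)) / (C2 * x * y)) powr (x / y)"
    and \<epsilon>: "\<epsilon> > 0" and K: "K \<ge> 1" "K * \<epsilon> \<ge> \<delta>" and q: "q > 0"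
    and small: "K * (\<Sum>j=1..m. \<P>(\<omega> in M. \<bar>Y j \<omega>\<bar> > \<delta>)) \<le> 1 / 2"
    and x: "x \<ge> \<epsilon>"
    and \<kappa>: "\<kappa> = min 1 (C1 / (8 * q))"
  shows "\<P>(\<omega> in M. centred_max M \<delta> m Y \<omega> > x)
    \<le> (1 + a' * (8 * K * q / C1)) * (\<Sum>j=1..m. \<P>(\<omega> in M. \<bar>Y j \<omega>\<bar> > \<kappa> * x))
      + b' * (16 * q / C2 * (1 / \<epsilon> + K)) powr q * (V powr q + B powr q) * x powr (- q)"
proof -
  define l where "l = K * x"
  define u where "u = C1 * (x / (2 * q))"
  have x0: "x > 0" using x \<epsilon> by simp
  have "K * \<epsilon> \<le> l" unfolding l_def by (rule mult_left_mono) (use x K in auto)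
  then have l\<delta>: "l \<ge> \<delta>" using K by simp
  have l: "l > 0" using l\<delta> \<delta> by simp
  have u: "u > 0" using C x0 q by (simp add: u_def)
  have V0: "V \<ge> 0" and B0: "B \<ge> 0" unfolding V_def B_def by (auto intro!: sum_nonneg)
  let ?P = "\<lambda>t. \<Sum>j=1..m. \<P>(\<omega> in M. \<bar>Y j \<omega>\<bar> > t)"
  have P_anti: "?P t \<le> ?P s" if "s \<le> t" for s t
  proof (rule sum_mono, rule finite_measure_mono)
    fix j assume "j \<in> {1..m}"
    then show "{\<omega> \<in> space M. \<bar>Y j \<omega>\<bar> > s} \<in> events" using meas[of j] by measurable
  qed (use that in auto)
  have split: "\<P>(\<omega> in M. centred_max M \<delta> m Y \<omega> > x)
    \<le> ?P l + \<P>(\<omega> in M. (MAX i\<in>{1..m}. \<bar>\<Sum>j=1..i. ctrunc M l (Y j) \<omega>\<bar>) \<ge> x / 2)"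
  proof (rule prob_centred_max_gt_le[OF m meas \<delta> l\<delta>])
    have "x * (K * ?P \<delta>) \<le> x * (1 / 2)" using small x0 by (intro mult_left_mono) auto
    then show "l * ?P \<delta> \<le> x / 2" by (simp add: l_def mult_ac)
  qed
  have large: "?P l \<le> ?P (\<kappa> * x)"
  proof (rule P_anti)
    show "\<kappa> * x \<le> l" unfolding l_def by (rule mult_right_mono) (use \<kappa> K x0 in auto)
  qed
  have max_ineq: "\<P>(\<omega> in M. (MAX i\<in>{1..m}. \<bar>\<Sum>j=1..i. ctrunc M l (Y j) \<omega>\<bar>) \<ge> x / 2)
    \<le> a * \<P>(\<omega> in M. (MAX j\<in>{1..m}. \<bar>ctrunc M l (Y j) \<omega>\<bar>) > u)
      + b * ((\<Sum>j=1..m. expectation (\<lambda>\<omega>. (ctrunc M l (Y j) \<omega>)\<^sup>2))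
          / (C2 * (x / 2) * (x / (2 * q)))) powr q"
    using ineq[of l "x / 2" "x / (2 * q)"] l x0 q by (simp add: u_def)
  have jump: "\<P>(\<omega> in M. (MAX j\<in>{1..m}. \<bar>ctrunc M l (Y j) \<omega>\<bar>) > u)
      \<le> 8 * K * q / C1 * ?P (\<kappa> * x)"
  proof -
    have "\<P>(\<omega> in M. (MAX j\<in>{1..m}. \<bar>ctrunc M l (Y j) \<omega>\<bar>) > u)
        = \<P>(\<omega> in M. \<exists>j\<in>{1..m}. \<bar>ctrunc M l (Y j) \<omega>\<bar> > u)"
      using m by (subst Max_gr_iff) auto
    also have "\<dots> \<le> (\<Sum>j=1..m. \<P>(\<omega> in M. \<bar>ctrunc M l (Y j) \<omega>\<bar> > u))"
    proof (rule prob_Bex_le_sum)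
      fix j assume "j \<in> {1..m}"
      then have [measurable]: "ctrunc M l (Y j) \<in> borel_measurable M"
        by (intro borel_measurable_ctrunc meas)
      show "{\<omega> \<in> space M. \<bar>ctrunc M l (Y j) \<omega>\<bar> > u} \<in> events" by measurable
    qed simp
    also have "\<dots> \<le> (\<Sum>j=1..m. 4 * l / u * \<P>(\<omega> in M. \<bar>Y j \<omega>\<bar> > u / 4))"
      by (rule sum_mono, rule prob_ctrunc_gt_le) (use meas l u in auto)
    also have "\<dots> = 8 * K * q / C1 * ?P (u / 4)"
      unfolding sum_distrib_left[symmetric] using x0 C q by (simp add: l_def u_def)
    also have "\<dots> \<le> 8 * K * q / C1 * ?P (\<kappa> * x)"
    proof (rule mult_left_mono, rule P_anti)
      have "\<kappa> * x \<le> C1 / (8 * q) * x" by (rule mult_right_mono) (use \<kappa> x0 in auto)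
      then show "\<kappa> * x \<le> u / 4" by (simp add: u_def)
    qed (use K C q in auto)
    finally show ?thesis .
  qed
  have square: "(\<Sum>j=1..m. expectation (\<lambda>\<omega>. (ctrunc M l (Y j) \<omega>)\<^sup>2)) \<le> 2 * V + 2 * l * B"
  proof -
    have "(\<Sum>j=1..m. expectation (\<lambda>\<omega>. (ctrunc M l (Y j) \<omega>)\<^sup>2))
      \<le> (\<Sum>j=1..m. 2 * variance (\<lambda>\<omega>. Y j \<omega> * indicator {\<omega>. \<bar>Y j \<omega>\<bar> \<le> \<delta>} \<omega>)
        + 2 * l * expectation (\<lambda>\<omega>. \<bar>Y j \<omega>\<bar> * indicator {\<omega>. \<bar>Y j \<omega>\<bar> > \<delta>} \<omega>))"
      by (rule sum_mono, rule expectation_ctrunc_square_le) (use meas \<delta> l\<delta> int in auto)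
    then show ?thesis by (simp add: V_def B_def sum.distrib sum_distrib_left)
  qed
  have power: "((2 * V + 2 * l * B) / (C2 * (x / 2) * (x / (2 * q)))) powr q
      \<le> (16 * q / C2 * (1 / \<epsilon> + K)) powr q * (V powr q + B powr q) * x powr (- q)"
  proof -
    define H where "H = 8 * q / C2 * (1 / \<epsilon> + K)"
    have H0: "H \<ge> 0" using q C K \<epsilon> by (simp add: H_def)
    have "(2 * V + 2 * l * B) / (C2 * (x / 2) * (x / (2 * q))) = 8 * q / C2 * (V / x + K * B) / x"
      using x0 q C by (simp add: l_def field_simps)
    also have "\<dots> \<le> 8 * q / C2 * ((1 / \<epsilon> + K) * (V + B)) / x"
    proof -
      have "V / x \<le> V / \<epsilon>" using x \<epsilon> V0 by (intro divide_left_mono) auto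
      moreover have "B / \<epsilon> \<ge> 0" "K * V \<ge> 0" using B0 V0 K \<epsilon> by auto
      ultimately have "V / x + K * B \<le> (1 / \<epsilon> + K) * (V + B)"
        by (simp add: algebra_simps add_divide_distrib)
      then show ?thesis using q C x0 by (intro divide_right_mono mult_left_mono) auto
    qed
    also have "\<dots> = H * (V + B) / x" by (simp add: H_def)
    finally have "((2 * V + 2 * l * B) / (C2 * (x / 2) * (x / (2 * q)))) powr q \<le> (H * (V + B) / x) powr q"
      using V0 B0 l C x0 q by (intro powr_mono2) auto
    also have "\<dots> = H powr q * (V + B) powr q * x powr (- q)"
      using H0 V0 B0 x0 by (simp add: powr_divide powr_mult powr_minus_divide)
    also have "\<dots> \<le> H powr q * (2 powr q * (V powr q + B powr q)) * x powr (- q)"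
      using powr_add_le[OF V0 B0 q] by (intro mult_right_mono mult_left_mono) auto
    also have "\<dots> = (2 * H) powr q * (V powr q + B powr q) * x powr (- q)"
      using H0 by (simp add: powr_mult)
    also have "2 * H = 16 * q / C2 * (1 / \<epsilon> + K)" by (simp add: H_def)
    finally show ?thesis .
  qed
  have "b * ((\<Sum>j=1..m. expectation (\<lambda>\<omega>. (ctrunc M l (Y j) \<omega>)\<^sup>2))
          / (C2 * (x / 2) * (x / (2 * q)))) powr q
      \<le> b' * ((2 * V + 2 * l * B) / (C2 * (x / 2) * (x / (2 * q)))) powr q"
    by (intro mult_mono powr_mono2 divide_right_mono square divide_nonneg_nonneg sum_nonneg)
      (use b q C x0 in auto)
  also have "\<dots> \<le> b' * ((16 * q / C2 * (1 / \<epsilon> + K)) powr q * (V powr q + B powr q) * x powr (- q))"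
    by (intro mult_left_mono power) (use b in auto)
  finally have second: "b * ((\<Sum>j=1..m. expectation (\<lambda>\<omega>. (ctrunc M l (Y j) \<omega>)\<^sup>2))
          / (C2 * (x / 2) * (x / (2 * q)))) powr q
      \<le> b' * (16 * q / C2 * (1 / \<epsilon> + K)) powr q * (V powr q + B powr q) * x powr (- q)"
    by (simp add: mult_ac)
  have first: "a * \<P>(\<omega> in M. (MAX j\<in>{1..m}. \<bar>ctrunc M l (Y j) \<omega>\<bar>) > u)
      \<le> a' * (8 * K * q / C1 * ?P (\<kappa> * x))"
    by (intro mult_mono jump) (use a in auto)
  have "(1 + a' * (8 * K * q / C1)) * ?P (\<kappa> * x)
      = ?P (\<kappa> * x) + a' * (8 * K * q / C1 * ?P (\<kappa> * x))" by (simp add: algebra_simps)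
  then show ?thesis using split large max_ineq first second by linarith
qed

end

section \<open>Excess moments of one row\<close>

context prob_space
begin

text \<open>
  The tail bound is integrated along \<open>x = \<epsilon> + t powr (1 / p)\<close> for \<open>t \<ge> 0\<close>. It enters as an assumption
  because only its shape in \<open>x\<close> matters here, not where the constants come from.
\<close>

lemma nn_integral_excess_centred_max_le:
  fixes Y :: "nat \<Rightarrow> 'a \<Rightarrow> real" and m :: nat and \<delta> \<kappa> :: real
  assumes meas: "\<And>j. j \<in> {1..m} \<Longrightarrow> Y j \<in> borel_measurable M"
    and pos: "p > 0" "\<delta> > 0" "\<epsilon> > 0" "\<kappa> > 0" "L \<ge> 0" "R \<ge> 0"
    and tail: "\<And>x. x \<ge> \<epsilon> \<Longrightarrow> \<P>(\<omega> in M. centred_max M \<delta> m Y \<omega> > x)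
      \<le> L * (\<Sum>j=1..m. \<P>(\<omega> in M. \<bar>Y j \<omega>\<bar> > \<kappa> * x)) + R * x powr (- q)"
  shows "(\<integral>\<^sup>+\<omega>. ennreal (max 0 (centred_max M \<delta> m Y \<omega> - \<epsilon>) powr p) \<partial>M)
    \<le> ennreal (L * \<kappa> powr (- p)) *
        ((\<Sum>j=1..m. \<integral>\<^sup>+t\<in>{\<delta> powr p..}. ennreal \<P>(\<omega> in M. \<bar>Y j \<omega>\<bar> powr p > t) \<partial>lborel)
          + ennreal (\<delta> powr p * (\<Sum>j=1..m. \<P>(\<omega> in M. \<bar>Y j \<omega>\<bar> > \<kappa> * \<epsilon>))))
      + ennreal R * (\<integral>\<^sup>+t\<in>{0..}. ennreal ((\<epsilon> + t powr (1 / p)) powr (- q)) \<partial>lborel)"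
proof -
  let ?x = "\<lambda>t. \<epsilon> + t powr (1 / p)"
  let ?G = "\<lambda>j t. ennreal \<P>(\<omega> in M. \<bar>Y j \<omega>\<bar> > \<kappa> * ?x t) * indicator {0..} t"
  let ?H = "\<lambda>t. ennreal (?x t powr (- q)) * indicator {0..} t"
  have G_meas: "?G j \<in> borel_measurable lborel" if "j \<in> {1..m}" for j
  proof -
    have [measurable]: "Y j \<in> borel_measurable M" using meas that by blast
    \<comment> \<open>The tail probability is the measure of a section of a measurable set.\<close>
    have "(\<lambda>t. emeasure M (Pair t -` {z \<in> space (borel \<Otimes>\<^sub>M M). \<kappa> * ?x (fst z) < \<bar>Y j (snd z)\<bar>}))
        \<in> borel_measurable borel"
      by (rule measurable_emeasure_Pair) measurable
    moreover have "Pair t -` {z \<in> space (borel \<Otimes>\<^sub>M M). \<kappa> * ?x (fst z) < \<bar>Y j (snd z)\<bar>}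
        = {\<omega> \<in> space M. \<kappa> * ?x t < \<bar>Y j \<omega>\<bar>}" for t
      by (auto simp: space_pair_measure)
    ultimately show ?thesis by (simp add: emeasure_eq_measure)
  qed
  have sum_meas: "(\<lambda>t. \<Sum>j=1..m. ?G j t) \<in> borel_measurable lborel"
    by (rule borel_measurable_sum) (rule G_meas)
  have sum_G: "(\<integral>\<^sup>+t. (\<Sum>j=1..m. ?G j t) \<partial>lborel) = (\<Sum>j=1..m. integral\<^sup>N lborel (?G j))"
    by (rule nn_integral_sum) (rule G_meas)
  have H_meas: "?H \<in> borel_measurable lborel" by measurable
  have "(\<integral>\<^sup>+\<omega>. ennreal (max 0 (centred_max M \<delta> m Y \<omega> - \<epsilon>) powr p) \<partial>M)
      = (\<integral>\<^sup>+t\<in>{0..}. ennreal \<P>(\<omega> in M. centred_max M \<delta> m Y \<omega> > ?x t) \<partial>lborel)"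
    by (rule nn_integral_excess_powr_eq) (use borel_measurable_centred_max meas pos in auto)
  also have "\<dots> \<le> (\<integral>\<^sup>+t. (ennreal L * (\<Sum>j=1..m. ?G j t) + ennreal R * ?H t) \<partial>lborel)"
  proof (rule nn_integral_mono)
    fix t :: real
    show "ennreal \<P>(\<omega> in M. centred_max M \<delta> m Y \<omega> > ?x t) * indicator {0..} t
      \<le> ennreal L * (\<Sum>j=1..m. ?G j t) + ennreal R * ?H t"
    proof (cases "t \<ge> 0")
      case True
      have "ennreal \<P>(\<omega> in M. centred_max M \<delta> m Y \<omega> > ?x t)
        \<le> ennreal (L * (\<Sum>j=1..m. \<P>(\<omega> in M. \<bar>Y j \<omega>\<bar> > \<kappa> * ?x t)) + R * ?x t powr (- q))"
        using tail[of "?x t"] by (intro ennreal_leI) simp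
      also have "\<dots> = ennreal L * (\<Sum>j=1..m. ennreal \<P>(\<omega> in M. \<bar>Y j \<omega>\<bar> > \<kappa> * ?x t))
          + ennreal R * ennreal (?x t powr (- q))"
        using pos by (simp add: ennreal_plus ennreal_mult sum_nonneg)
      finally show ?thesis using True by simp
    qed simp
  qed
  also have "\<dots> = ennreal L * (\<Sum>j=1..m. integral\<^sup>N lborel (?G j)) + ennreal R * integral\<^sup>N lborel ?H"
    using nn_integral_add[OF borel_measurable_times_ennreal[OF borel_measurable_const sum_meas]
        borel_measurable_times_ennreal[OF borel_measurable_const H_meas], of "ennreal L" "ennreal R"]
    unfolding nn_integral_cmult[OF sum_meas] nn_integral_cmult[OF H_meas] sum_G .
  also have "(\<Sum>j=1..m. integral\<^sup>N lborel (?G j)) \<le> (\<Sum>j=1..m. ennreal (\<kappa> powr (- p)) *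
      ((\<integral>\<^sup>+t\<in>{\<delta> powr p..}. ennreal \<P>(\<omega> in M. \<bar>Y j \<omega>\<bar> powr p > t) \<partial>lborel)
        + ennreal (\<delta> powr p * \<P>(\<omega> in M. \<bar>Y j \<omega>\<bar> > \<kappa> * \<epsilon>))))"
    by (rule sum_mono, rule nn_integral_scaled_tail_le) (use meas pos in auto)
  also have "\<dots> = ennreal (\<kappa> powr (- p)) *
      ((\<Sum>j=1..m. \<integral>\<^sup>+t\<in>{\<delta> powr p..}. ennreal \<P>(\<omega> in M. \<bar>Y j \<omega>\<bar> powr p > t) \<partial>lborel)
        + ennreal (\<delta> powr p * (\<Sum>j=1..m. \<P>(\<omega> in M. \<bar>Y j \<omega>\<bar> > \<kappa> * \<epsilon>))))"
    by (simp add: sum_distrib_left[symmetric] sum.distrib ennreal_mult sum_nonneg)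
  finally show ?thesis
    using pos by (simp add: ennreal_mult mult.assoc mult_left_mono)
qed

text \<open>
  The tail bound is available only for rows with small tail probabilities, hence only from some row on;
  the finitely many earlier rows are covered by this crude moment bound.
\<close>

lemma nn_integral_excess_centred_max_finite:
  fixes Y :: "nat \<Rightarrow> 'a \<Rightarrow> real"
  assumes m: "m > 0" and meas: "\<And>j. j \<in> {1..m} \<Longrightarrow> Y j \<in> borel_measurable M"
    and p: "p > 0" and \<delta>: "\<delta> > 0" and \<epsilon>: "\<epsilon> > 0"
    and fin: "\<And>j. j \<in> {1..m} \<Longrightarrow>
      (\<integral>\<^sup>+t\<in>{\<delta> powr p..}. ennreal \<P>(\<omega> in M. \<bar>Y j \<omega>\<bar> powr p > t) \<partial>lborel) < \<infinity>"
  shows "(\<integral>\<^sup>+\<omega>. ennreal (max 0 (centred_max M \<delta> m Y \<omega> - \<epsilon>) powr p) \<partial>M) < \<infinity>"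
proof -
  let ?F = "\<lambda>j. expectation (\<lambda>\<omega>. Y j \<omega> * indicator {\<omega>. \<bar>Y j \<omega>\<bar> \<le> \<delta>} \<omega>)"
  define h where "h = (\<lambda>j \<omega>. max 0 (\<bar>Y j \<omega>\<bar> powr p - \<delta> powr p))"
  define D where "D = real m powr p * 2 powr p"
  define e where "e = (\<lambda>j. \<delta> powr p + \<bar>?F j\<bar> powr p)"
  have D0: "D \<ge> 0" by (simp add: D_def)
  have h0: "h j \<omega> \<ge> 0" for j \<omega> by (simp add: h_def)
  have h_meas: "h j \<in> borel_measurable M" if "j \<in> {1..m}" for j
    using meas[OF that] unfolding h_def by measurable
  have e0: "e j \<ge> 0" for j by (simp add: e_def)
  have bd: "max 0 (centred_max M \<delta> m Y \<omega> - \<epsilon>) powr p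
      \<le> D * (\<Sum>j=1..m. h j \<omega> + e j)" for \<omega>
  proof -
    have "centred_max M \<delta> m Y \<omega> \<le> (\<Sum>j=1..m. \<bar>Y j \<omega>\<bar> + \<bar>?F j\<bar>)"
      unfolding centred_max_def
    proof (rule Max.boundedI)
      fix y assume "y \<in> (\<lambda>i. \<bar>\<Sum>j=1..i. (Y j \<omega> - ?F j)\<bar>) ` {1..m}"
      then obtain i where i: "i \<in> {1..m}" and y: "y = \<bar>\<Sum>j=1..i. (Y j \<omega> - ?F j)\<bar>" by blast
      have "y \<le> (\<Sum>j=1..i. \<bar>Y j \<omega> - ?F j\<bar>)" unfolding y by (rule sum_abs)
      also have "\<dots> \<le> (\<Sum>j=1..m. \<bar>Y j \<omega> - ?F j\<bar>)" by (rule sum_mono2) (use i in auto)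
      also have "\<dots> \<le> (\<Sum>j=1..m. \<bar>Y j \<omega>\<bar> + \<bar>?F j\<bar>)" by (rule sum_mono) (rule abs_triangle_ineq4)
      finally show "y \<le> (\<Sum>j=1..m. \<bar>Y j \<omega>\<bar> + \<bar>?F j\<bar>)" .
    qed (use m in auto)
    moreover have "(\<Sum>j=1..m. \<bar>Y j \<omega>\<bar> + \<bar>?F j\<bar>) \<ge> 0" by (intro sum_nonneg) auto
    ultimately have "max 0 (centred_max M \<delta> m Y \<omega> - \<epsilon>) powr p \<le> (\<Sum>j=1..m. \<bar>Y j \<omega>\<bar> + \<bar>?F j\<bar>) powr p"
      using \<epsilon> p by (intro powr_mono2) auto
    also have "\<dots> \<le> real m powr p * (\<Sum>j=1..m. (\<bar>Y j \<omega>\<bar> + \<bar>?F j\<bar>) powr p)"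
      using powr_sum_le[of "{1..m}" "\<lambda>j. \<bar>Y j \<omega>\<bar> + \<bar>?F j\<bar>" p] p by simp
    also have "\<dots> \<le> real m powr p * (\<Sum>j=1..m. 2 powr p * (h j \<omega> + e j))"
    proof (intro mult_left_mono sum_mono)
      fix j
      have "(\<bar>Y j \<omega>\<bar> + \<bar>?F j\<bar>) powr p \<le> 2 powr p * (\<bar>Y j \<omega>\<bar> powr p + \<bar>?F j\<bar> powr p)"
        using p by (intro powr_add_le) auto
      also have "\<dots> \<le> 2 powr p * (h j \<omega> + e j)"
        by (intro mult_left_mono) (auto simp: e_def h_def)
      finally show "(\<bar>Y j \<omega>\<bar> + \<bar>?F j\<bar>) powr p \<le> 2 powr p * (h j \<omega> + e j)" .
    qed simp
    finally show ?thesis by (simp add: D_def sum_distrib_left mult.assoc)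
  qed
  have "(\<integral>\<^sup>+\<omega>. ennreal (max 0 (centred_max M \<delta> m Y \<omega> - \<epsilon>) powr p) \<partial>M)
      \<le> (\<integral>\<^sup>+\<omega>. ennreal D * (\<Sum>j=1..m. ennreal (h j \<omega>) + ennreal (e j)) \<partial>M)"
  proof (rule nn_integral_mono)
    fix \<omega>
    have "ennreal (max 0 (centred_max M \<delta> m Y \<omega> - \<epsilon>) powr p)
        \<le> ennreal (D * (\<Sum>j=1..m. h j \<omega> + e j))"
      by (rule ennreal_leI) (rule bd)
    also have "\<dots> = ennreal D * (\<Sum>j=1..m. ennreal (h j \<omega> + e j))"
      using D0 e0 h0 by (simp add: ennreal_mult sum_nonneg add_nonneg_nonneg sum_ennreal del: ennreal_plus)
    also have "\<dots> = ennreal D * (\<Sum>j=1..m. ennreal (h j \<omega>) + ennreal (e j))"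
      using e0 h0 by simp
    finally show "ennreal (max 0 (centred_max M \<delta> m Y \<omega> - \<epsilon>) powr p)
        \<le> ennreal D * (\<Sum>j=1..m. ennreal (h j \<omega>) + ennreal (e j))" .
  qed
  also have "\<dots> = ennreal D * (\<Sum>j=1..m.
      (\<integral>\<^sup>+\<omega>. ennreal (h j \<omega>) \<partial>M) + ennreal (e j))"
  proof -
    have *: "(\<lambda>\<omega>. ennreal (h j \<omega>)) \<in> borel_measurable M" if "j \<in> {1..m}" for j
      using h_meas[OF that] by measurable
    have "(\<integral>\<^sup>+\<omega>. ennreal (h j \<omega>) + ennreal (e j) \<partial>M) = (\<integral>\<^sup>+\<omega>. ennreal (h j \<omega>) \<partial>M) + ennreal (e j)"
      if "j \<in> {1..m}" for j
      using nn_integral_add[OF *[OF that], of "\<lambda>_. ennreal (e j)"] by (simp add: emeasure_space_1)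
    moreover have **: "(\<lambda>\<omega>. ennreal (h j \<omega>) + ennreal (e j)) \<in> borel_measurable M"
      if "j \<in> {1..m}" for j
      using *[OF that] by measurable
    moreover have "(\<integral>\<^sup>+\<omega>. (\<Sum>j=1..m. ennreal (h j \<omega>) + ennreal (e j)) \<partial>M)
        = (\<Sum>j=1..m. \<integral>\<^sup>+\<omega>. ennreal (h j \<omega>) + ennreal (e j) \<partial>M)"
      by (rule nn_integral_sum) (rule **)
    moreover have "(\<lambda>\<omega>. \<Sum>j=1..m. ennreal (h j \<omega>) + ennreal (e j)) \<in> borel_measurable M"
      by (rule borel_measurable_sum) (rule **)
    ultimately show ?thesis by (simp add: nn_integral_cmult)
  qed
  also have "\<dots> < \<infinity>"
  proof -
    have "(\<integral>\<^sup>+\<omega>. ennreal (h j \<omega>) \<partial>M) < \<infinity>" if "j \<in> {1..m}" for j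
    proof -
      have [measurable]: "Y j \<in> borel_measurable M" by (rule meas[OF that])
      show ?thesis unfolding h_def using fin[OF that] by (subst nn_integral_tail_eq[symmetric]) auto
    qed
    then have "(\<Sum>j=1..m. (\<integral>\<^sup>+\<omega>. ennreal (h j \<omega>) \<partial>M) + ennreal (e j)) < \<infinity>"
      by (simp del: atLeastAtMost_iff)
    then show ?thesis by (simp add: ennreal_mult_less_top)
  qed
  finally show ?thesis .
qed

end

section \<open>Summation over the rows\<close>

lemma suminf_ennreal_finite_comparison:
  fixes f g :: "nat \<Rightarrow> ennreal"
  assumes fin: "\<And>n. f n < \<infinity>" and le: "\<And>n. n \<ge> N \<Longrightarrow> f n \<le> g n" and g: "(\<Sum>n. g n) < \<infinity>"
  shows "(\<Sum>n. f n) < \<infinity>"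
proof -
  have "(\<Sum>n. f n) = (\<Sum>n. f (n + N)) + (\<Sum>n<N. f n)" by (rule suminf_offset) (rule summableI)
  also have "(\<Sum>n. f (n + N)) \<le> (\<Sum>n. g (n + N))" by (intro suminf_le summableI le) auto
  also have "\<dots> \<le> (\<Sum>n. g (n + N)) + (\<Sum>n<N. g n)" by simp
  also have "\<dots> = (\<Sum>n. g n)" by (rule suminf_offset[symmetric]) (rule summableI)
  finally show ?thesis using g fin by (auto simp: less_top[symmetric] top_unique)
qed

theorem corollary1:
  fixes M :: "'a measure"
    and k :: "nat \<Rightarrow> nat"
    and X :: "nat \<Rightarrow> nat \<Rightarrow> 'a \<Rightarrow> real"
    and c \<alpha> \<beta> :: "nat \<Rightarrow> real"
    and p q \<delta> :: real
  assumes "prob_space M"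
    and k_pos: "\<And>n. n \<ge> 1 \<Longrightarrow> k n > 0"
    and k_lim: "filterlim k at_top sequentially"
    and p: "p \<ge> 1"
    and c_pos: "\<And>n. n \<ge> 1 \<Longrightarrow> c n > 0"
    and rv: "\<And>n j. n \<ge> 1 \<Longrightarrow> j \<in> {1..k n} \<Longrightarrow> X n j \<in> borel_measurable M"
    and \<alpha>_nonneg: "\<And>n. n \<ge> 1 \<Longrightarrow> \<alpha> n \<ge> 0"
    and \<beta>_nonneg: "\<And>n. n \<ge> 1 \<Longrightarrow> \<beta> n \<ge> 0"
    and max_ineq: "maximal_ineq M k X \<alpha> \<beta>"
    and \<alpha>_bdd: "\<alpha> \<in> O(\<lambda>_. 1)"
    and \<beta>_bdd: "\<beta> \<in> O(\<lambda>_. 1)"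
    and i': "\<And>x. x > 0 \<Longrightarrow>
      (\<Sum>n. ennreal (c (Suc n) *
        (\<Sum>j=1..k (Suc n). \<P>(\<omega> in M. \<bar>X (Suc n) j \<omega>\<bar> > x)))) < \<infinity>"
    and \<delta>: "\<delta> > 0"
    and b': "(\<lambda>n. \<Sum>j=1..k n. \<P>(\<omega> in M. \<bar>X n j \<omega>\<bar> > \<delta>)) \<in> o(\<lambda>_. 1)"
    and c': "(\<Sum>n. \<Sum>j=1..k (Suc n). ennreal (c (Suc n)) *
        (\<integral>\<^sup>+t\<in>{\<delta> powr p..}. ennreal \<P>(\<omega> in M. \<bar>X (Suc n) j \<omega>\<bar> powr p > t) \<partial>lborel)) < \<infinity>"
    and q: "q > p"
    and d'1: "(\<Sum>n. ennreal (c (Suc n) *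
        (\<Sum>j=1..k (Suc n). prob_space.variance M
          (\<lambda>\<omega>. X (Suc n) j \<omega> * indicator {\<omega>. \<bar>X (Suc n) j \<omega>\<bar> \<le> \<delta>} \<omega>)) powr q)) < \<infinity>"
    and d'2: "(\<Sum>n. ennreal (c (Suc n)) *
        ennpowr (\<Sum>j=1..k (Suc n).
          \<integral>\<^sup>+\<omega>. ennreal (\<bar>X (Suc n) j \<omega>\<bar> * indicator {\<omega>. \<bar>X (Suc n) j \<omega>\<bar> > \<delta>} \<omega>) \<partial>M) q) < \<infinity>"
  shows "\<forall>\<epsilon>>0. (\<Sum>n. ennreal (c (Suc n)) *
        (\<integral>\<^sup>+\<omega>. ennreal (max 0 ((MAX i\<in>{1..k (Suc n)}.
            \<bar>\<Sum>j=1..i. (X (Suc n) j \<omega> - prob_space.expectation M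
                (\<lambda>\<omega>'. X (Suc n) j \<omega>' * indicator {\<omega>. \<bar>X (Suc n) j \<omega>\<bar> \<le> \<delta>} \<omega>'))\<bar>) - \<epsilon>) powr p) \<partial>M))
      < \<infinity>"
proof (intro allI impI)
  interpret prob_space M by fact
  fix \<epsilon> :: real assume \<epsilon>: "\<epsilon> > 0"
  have p0: "p > 0" and q0: "q > 0" using p q by auto
  define P where "P = (\<lambda>n x. \<Sum>j=1..k n. \<P>(\<omega> in M. \<bar>X n j \<omega>\<bar> > x))"
  define I where "I = (\<lambda>n j. \<integral>\<^sup>+t\<in>{\<delta> powr p..}. ennreal \<P>(\<omega> in M. \<bar>X n j \<omega>\<bar> powr p > t) \<partial>lborel)"
  define V where "V = (\<lambda>n. \<Sum>j=1..k n. variance (\<lambda>\<omega>. X n j \<omega> * indicator {\<omega>. \<bar>X n j \<omega>\<bar> \<le> \<delta>} \<omega>))"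
  define W where "W = (\<lambda>n j. \<integral>\<^sup>+\<omega>. ennreal (\<bar>X n j \<omega>\<bar> * indicator {\<omega>. \<bar>X n j \<omega>\<bar> > \<delta>} \<omega>) \<partial>M)"
  define B where "B = (\<lambda>n. \<Sum>j=1..k n. expectation (\<lambda>\<omega>. \<bar>X n j \<omega>\<bar> * indicator {\<omega>. \<bar>X n j \<omega>\<bar> > \<delta>} \<omega>))"
  define E where "E = (\<lambda>n. \<integral>\<^sup>+\<omega>. ennreal (max 0 (centred_max M \<delta> (k n) (X n) \<omega> - \<epsilon>) powr p) \<partial>M)"
  have P0: "P n x \<ge> 0" for n x by (simp add: P_def sum_nonneg)
  have c0: "c (Suc n) > 0" for n by (rule c_pos) simp
  note meas = rv[OF Suc_leI[OF zero_less_Suc, unfolded One_nat_def[symmetric]]]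

  have I_fin: "I (Suc n) j < \<infinity>" if "j \<in> {1..k (Suc n)}" for n j
  proof -
    have "(\<Sum>j=1..k (Suc n). ennreal (c (Suc n)) * I (Suc n) j) < \<infinity>"
      unfolding I_def by (rule ennreal_suminf_lessD[OF c'])
    then have "ennreal (c (Suc n)) * I (Suc n) j < \<infinity>" using that by simp
    then show ?thesis using c0[of n] by (auto simp: ennreal_mult_less_top)
  qed
  \<comment> \<open>Every \<open>c (Suc n)\<close> is positive, so summability of the weighted series makes each row
    finite; the first moments over \<open>\<bar>X n j\<bar> > \<delta>\<close> may then be treated as real numbers.\<close>
  have W_fin: "W (Suc n) j < \<infinity>" if "j \<in> {1..k (Suc n)}" for n j
  proof -
    have "ennreal (c (Suc n)) * ennpowr (\<Sum>j=1..k (Suc n). W (Suc n) j) q < \<infinity>"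
      unfolding W_def by (rule ennreal_suminf_lessD[OF d'2])
    then have "(\<Sum>j=1..k (Suc n). W (Suc n) j) < \<infinity>"
      using c0[of n] by (auto simp: ennreal_mult_less_top ennpowr_def less_top split: if_splits)
    then show ?thesis using that by simp
  qed
  have W_int: "integrable M (\<lambda>\<omega>. \<bar>X (Suc n) j \<omega>\<bar> * indicator {\<omega>. \<bar>X (Suc n) j \<omega>\<bar> > \<delta>} \<omega>)"
    if "j \<in> {1..k (Suc n)}" for n j
  proof -
    have [measurable]: "X (Suc n) j \<in> borel_measurable M" by (rule meas[OF that])
    show ?thesis
      by (rule integrableI_nonneg) (use W_fin[OF that] in \<open>auto simp: W_def\<close>)
  qed
  have B0: "B n \<ge> 0" for n unfolding B_def by (intro sum_nonneg integral_nonneg_AE) auto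
  have B_powr: "ennpowr (\<Sum>j=1..k (Suc n). W (Suc n) j) q = ennreal (B (Suc n) powr q)" for n
  proof -
    have "(\<Sum>j=1..k (Suc n). W (Suc n) j) = (\<Sum>j=1..k (Suc n). ennreal (expectation
        (\<lambda>\<omega>. \<bar>X (Suc n) j \<omega>\<bar> * indicator {\<omega>. \<bar>X (Suc n) j \<omega>\<bar> > \<delta>} \<omega>)))"
      unfolding W_def by (intro sum.cong refl nn_integral_eq_integral W_int) auto
    also have "\<dots> = ennreal (B (Suc n))" unfolding B_def by (intro sum_ennreal integral_nonneg_AE) auto
    finally show ?thesis using B0 by (simp add: ennpowr_def)
  qed

  obtain C1 C2 where C: "C1 > 0" "C2 > 0" and ineq_all: "\<forall>n\<ge>1. \<forall>l>0. \<forall>x>0. \<forall>y>0.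
      \<P>(\<omega> in M. (MAX i\<in>{1..k n}. \<bar>\<Sum>j=1..i. ctrunc M l (X n j) \<omega>\<bar>) \<ge> x)
      \<le> \<alpha> n * \<P>(\<omega> in M. (MAX j\<in>{1..k n}. \<bar>ctrunc M l (X n j) \<omega>\<bar>) > C1 * y)
        + \<beta> n * ((\<Sum>j=1..k n. expectation (\<lambda>\<omega>. (ctrunc M l (X n j) \<omega>)\<^sup>2)) / (C2 * x * y)) powr (x / y)"
    using max_ineq unfolding maximal_ineq_def by (elim exE conjE) (rule that)
  note ineq = ineq_all[rule_format]
  obtain a where a: "a > 0" "eventually (\<lambda>n. norm (\<alpha> n) \<le> a * norm (1::real)) sequentially"
    using landau_o.bigE[OF \<alpha>_bdd] by blast
  obtain b where b: "b > 0" "eventually (\<lambda>n. norm (\<beta> n) \<le> b * norm (1::real)) sequentially"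
    using landau_o.bigE[OF \<beta>_bdd] by blast
  define K where "K = 1 + \<delta> / \<epsilon>"
  have K: "K \<ge> 1" "K * \<epsilon> \<ge> \<delta>" using \<delta> \<epsilon> by (auto simp: K_def field_simps)
  \<comment> \<open>From some row on, the drift at level \<open>K * x\<close> is at most \<open>x / 2\<close>.\<close>
  have "eventually (\<lambda>n. norm (P n \<delta>) \<le> 1 / (2 * K) * norm (1::real)) sequentially"
    unfolding P_def by (rule landau_o.smallD[OF b']) (use K in auto)
  with a(2) b(2) have "eventually (\<lambda>n. \<alpha> n \<le> a \<and> \<beta> n \<le> b \<and> K * P n \<delta> \<le> 1 / 2) sequentially"
    by eventually_elim (use K in \<open>auto simp: field_simps abs_of_nonneg[OF P0]\<close>)
  then obtain N where N: "\<And>n. n \<ge> N \<Longrightarrow> \<alpha> n \<le> a \<and> \<beta> n \<le> b \<and> K * P n \<delta> \<le> 1 / 2"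
    by (auto simp: eventually_sequentially)

  define \<kappa> where "\<kappa> = min 1 (C1 / (8 * q))"
  define L where "L = 1 + a * (8 * K * q / C1)"
  define Q where "Q = b * (16 * q / C2 * (1 / \<epsilon> + K)) powr q"
  define T where "T = (\<integral>\<^sup>+t\<in>{0..}. ennreal ((\<epsilon> + t powr (1 / p)) powr (- q)) \<partial>lborel)"
  have \<kappa>: "\<kappa> > 0" using C q0 by (simp add: \<kappa>_def)
  have L: "L \<ge> 0" and Q: "Q \<ge> 0" using a b C K q0 by (auto simp: L_def Q_def)
  have T: "T < \<infinity>" unfolding T_def by (rule nn_integral_shifted_powr_finite) (use \<epsilon> p q in auto)

  define A1 where "A1 = ennreal (L * \<kappa> powr (- p))"
  define A2 where "A2 = A1 * ennreal (\<delta> powr p)"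
  define A3 where "A3 = ennreal Q * T"
  have A: "A1 < \<infinity>" "A2 < \<infinity>" "A3 < \<infinity>"
    using T by (auto simp: A1_def A2_def A3_def ennreal_mult_less_top)
  \<comment> \<open>The four summands belong to the four summability hypotheses. The third and the fourth share
    the factor \<open>A3\<close> since \<open>V powr q\<close> and \<open>B powr q\<close> enter the tail bound through their sum.\<close>
  let ?g = "\<lambda>n. A1 * (\<Sum>j=1..k (Suc n). ennreal (c (Suc n)) * I (Suc n) j)
      + A2 * ennreal (c (Suc n) * P (Suc n) (\<kappa> * \<epsilon>))
      + A3 * ennreal (c (Suc n) * V (Suc n) powr q)
      + A3 * (ennreal (c (Suc n)) * ennpowr (\<Sum>j=1..k (Suc n). W (Suc n) j) q)"
  have "(\<Sum>n. ennreal (c (Suc n)) * E (Suc n)) < \<infinity>"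
  proof (rule suminf_ennreal_finite_comparison)
    fix n
    have "E (Suc n) < \<infinity>"
      unfolding E_def
      by (rule nn_integral_excess_centred_max_finite)
        (use k_pos meas p0 \<delta> \<epsilon> I_fin in \<open>auto simp: I_def\<close>)
    then show "ennreal (c (Suc n)) * E (Suc n) < \<infinity>" by (simp add: ennreal_mult_less_top)
  next
    fix n assume n: "n \<ge> N"
    have k_n: "k (Suc n) > 0" by (rule k_pos) simp
    have \<alpha>_n: "0 \<le> \<alpha> (Suc n)" "\<alpha> (Suc n) \<le> a" and \<beta>_n: "0 \<le> \<beta> (Suc n)" "\<beta> (Suc n) \<le> b"
      using N[of "Suc n"] n \<alpha>_nonneg \<beta>_nonneg by auto
    have small: "K * (\<Sum>j=1..k (Suc n). \<P>(\<omega> in M. \<bar>X (Suc n) j \<omega>\<bar> > \<delta>)) \<le> 1 / 2"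
      using N[of "Suc n"] n by (simp add: P_def)
    have "E (Suc n) \<le> ennreal (L * \<kappa> powr (- p)) * ((\<Sum>j=1..k (Suc n). I (Suc n) j)
          + ennreal (\<delta> powr p * P (Suc n) (\<kappa> * \<epsilon>)))
        + ennreal (Q * (V (Suc n) powr q + B (Suc n) powr q)) * T"
      unfolding E_def I_def P_def T_def
    proof (rule nn_integral_excess_centred_max_le)
      fix x assume x: "x \<ge> \<epsilon>"
      show "\<P>(\<omega> in M. centred_max M \<delta> (k (Suc n)) (X (Suc n)) \<omega> > x)
        \<le> L * (\<Sum>j=1..k (Suc n). \<P>(\<omega> in M. \<bar>X (Suc n) j \<omega>\<bar> > \<kappa> * x))
          + Q * (V (Suc n) powr q + B (Suc n) powr q) * x powr (- q)"
        unfolding L_def Q_def V_def B_def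
        by (rule prob_centred_max_tail_le[where a = "\<alpha> (Suc n)" and b = "\<beta> (Suc n)" and K = K
              and \<epsilon> = \<epsilon> and ?C1.0 = C1 and ?C2.0 = C2])
          (rule k_n meas \<delta> W_int C \<alpha>_n \<beta>_n ineq[of "Suc n"] \<epsilon> K q0 small x \<kappa>_def | assumption | simp)+
    qed (use meas p0 \<delta> \<epsilon> \<kappa> L Q in auto)
    then have "ennreal (c (Suc n)) * E (Suc n) \<le> ennreal (c (Suc n)) *
        (A1 * ((\<Sum>j=1..k (Suc n). I (Suc n) j) + ennreal (\<delta> powr p * P (Suc n) (\<kappa> * \<epsilon>)))
        + ennreal (Q * (V (Suc n) powr q + B (Suc n) powr q)) * T)"
      unfolding A1_def by (rule mult_left_mono) simp
    also have "\<dots> = ?g n"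
      using Q P0 c0[of n] unfolding B_powr A2_def A3_def
      by (simp add: ennreal_mult less_imp_le sum_distrib_left[symmetric] distrib_left distrib_right mult_ac add_ac)
    finally show "ennreal (c (Suc n)) * E (Suc n) \<le> ?g n" .
  next
    have "(\<Sum>n. ?g n) = A1 * (\<Sum>n. \<Sum>j=1..k (Suc n). ennreal (c (Suc n)) * I (Suc n) j)
      + A2 * (\<Sum>n. ennreal (c (Suc n) * P (Suc n) (\<kappa> * \<epsilon>)))
      + A3 * (\<Sum>n. ennreal (c (Suc n) * V (Suc n) powr q))
      + A3 * (\<Sum>n. ennreal (c (Suc n)) * ennpowr (\<Sum>j=1..k (Suc n). W (Suc n) j) q)"
      by (simp only: suminf_add[OF summableI summableI, symmetric] ennreal_suminf_cmult)
    also have "\<dots> < \<infinity>"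
      using A c' i'[of "\<kappa> * \<epsilon>"] d'1 d'2 \<kappa> \<epsilon>
      unfolding I_def P_def V_def W_def infinity_ennreal_def
      by (intro ennreal_add_less_top[THEN iffD2] conjI ennreal_mult_less_top[THEN iffD2] disjI2) auto
    finally show "(\<Sum>n. ?g n) < \<infinity>" .
  qed
  then show "(\<Sum>n. ennreal (c (Suc n)) *
        (\<integral>\<^sup>+\<omega>. ennreal (max 0 ((MAX i\<in>{1..k (Suc n)}.
            \<bar>\<Sum>j=1..i. (X (Suc n) j \<omega> - prob_space.expectation M
                (\<lambda>\<omega>'. X (Suc n) j \<omega>' * indicator {\<omega>. \<bar>X (Suc n) j \<omega>\<bar> \<le> \<delta>} \<omega>'))\<bar>) - \<epsilon>) powr p) \<partial>M))
      < \<infinity>"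
    unfolding E_def centred_max_def .
qed

end
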